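(* For $n\geq 0$, let $P_r$ denote the set of projections of rank $r$ of the Temperley--Lieb monoid $\mathcal{TL}_n$, and let $Q(\mathcal{TL}_n)=P_0\cup P_2\cup P_4$ if $n$ is even and $Q(\mathcal{TL}_n)=P_1\cup P_3$ if $n$ is odd. Then $$|Q(\mathcal{TL}_n)|=\begin{cases}C(k+1)-C(k)&\text{if $n=2k-1$ is odd}\\ C(k+2)-2C(k+1)+C(k)&\text{if $n=2k$ is even,}\end{cases}$$ where $C(m)$ denotes the $m$th Catalan number.
   Context: For an integer $n\ge 0$ let $\mathbf n=\{1,\dots,n\}$ and $\mathbf n'=\{1',\dots,n'\}$. The partition monoid $\mathcal P_n$ is the set of all set partitions of $\mathbf n\cup\mathbf n'$. Product of $\alpha,\beta\in\mathcal P_n$: with $\mathbf n''=\{1'',\dots,n''\}$, rename each $x'$ in $\alpha$ as $x''$ and each (unprimed) $x$ in $\beta$ as $x''$; consider the equivalence on $\mathbf n\cup\mathbf n''\cup\mathbf n'$ generated by the blocks of these two renamed partitions; $x,y\in\mathbf n\cup\mathbf n'$ are in the same block of $\alpha\beta$ iff they are related by this equivalence. $\alpha^*$ is obtained from $\alpha$ by interchanging $x$ and $x'$ for all $x$. The rank of $\alpha$ is the number of its blocks meeting both $\mathbf n$ and $\mathbf n'$. A projection is an element $\varepsilon$ with $\varepsilon^2=\varepsilon=\varepsilon^*$. $\alpha$ is planar if it can be drawn by a graph, whose connected components are the blocks, with vertices $1,\dots,n$ in order on an upper row and $1',\dots,n'$ in order on a lower row, with all edges inside the rectangle spanned by the vertices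 and with no crossings (equivalently, $\alpha$ is a non-crossing partition for the cyclic order $1,\dots,n,n',\dots,1'$). $\mathcal{TL}_n$ is the submonoid of $\mathcal P_n$ of all planar partitions all of whose blocks have size exactly $2$. (For small $n$ some of the sets $P_r$ are empty.) $C(m)=\frac1{m+1}\binom{2m}{m}$. *)

theory Defs
  imports Complex_Main "HOL-Library.Disjoint_Sets"
begin

text \<open>
  \<open>Upper x\<close>, \<open>Lower x\<close> and \<open>Middle x\<close> stand for \<open>x\<close>, \<open>x'\<close> and \<open>x''\<close>.
  Middle vertices occur only while a product is being formed.
\<close>

datatype vertex = Upper nat | Middle nat | Lower nat

definition upper_row :: "nat \<Rightarrow> vertex set" where
  "upper_row n = Upper ` {1..n}"

definition lower_row :: "nat \<Rightarrow> vertex set" where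
  "lower_row n = Lower ` {1..n}"

definition vertices :: "nat \<Rightarrow> vertex set" where
  "vertices n = upper_row n \<union> lower_row n"

definition partition_monoid :: "nat \<Rightarrow> vertex set set set" where
  "partition_monoid n = {\<alpha>. partition_on (vertices n) \<alpha>}"

fun lower_to_middle :: "vertex \<Rightarrow> vertex" where
  "lower_to_middle (Lower x) = Middle x"
| "lower_to_middle v = v"

fun upper_to_middle :: "vertex \<Rightarrow> vertex" where
  "upper_to_middle (Upper x) = Middle x"
| "upper_to_middle v = v"

fun flip :: "vertex \<Rightarrow> vertex" where
  "flip (Upper x) = Lower x"
| "flip (Lower x) = Upper x"
| "flip (Middle x) = Middle x"

text \<open>
  The equivalence relation on \<open>\<Union>\<B>\<close> generated by the blocks in \<open>\<B>\<close>: the relation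
  below the closure is already symmetric and reflexive on \<open>\<Union>\<B>\<close>.
\<close>

definition generated_equiv :: "vertex set set \<Rightarrow> (vertex \<times> vertex) set" where
  "generated_equiv \<B> = (\<Union>B\<in>\<B>. B \<times> B)\<^sup>+"

definition product_equiv :: "vertex set set \<Rightarrow> vertex set set \<Rightarrow> (vertex \<times> vertex) set" where
  "product_equiv \<alpha> \<beta> =
     generated_equiv ((`) lower_to_middle ` \<alpha> \<union> (`) upper_to_middle ` \<beta>)"

definition pprod :: "nat \<Rightarrow> vertex set set \<Rightarrow> vertex set set \<Rightarrow> vertex set set" where
  "pprod n \<alpha> \<beta> = vertices n // (product_equiv \<alpha> \<beta> \<inter> vertices n \<times> vertices n)"

definition pstar :: "vertex set set \<Rightarrow> vertex set set" where
  "pstar \<alpha> = (`) flip ` \<alpha>"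

definition prank :: "nat \<Rightarrow> vertex set set \<Rightarrow> nat" where
  "prank n \<alpha> = card {B \<in> \<alpha>. B \<inter> upper_row n \<noteq> {} \<and> B \<inter> lower_row n \<noteq> {}}"

text \<open>
  Position on the boundary of the rectangle, in the order \<open>1, \<dots>, n, n', \<dots>, 1'\<close>.
  The value at middle vertices is irrelevant.
\<close>

fun cyc_pos :: "nat \<Rightarrow> vertex \<Rightarrow> nat" where
  "cyc_pos n (Upper x) = x"
| "cyc_pos n (Lower x) = 2 * n + 1 - x"
| "cyc_pos n (Middle x) = 0"

text \<open>
  Planarity of a partition of \<open>vertices n\<close>, as the non-crossing condition for this order.
  Cutting the cyclic order at one point is harmless because crossing of two blocks
  is invariant under rotation.
\<close>

definition planar :: "nat \<Rightarrow> vertex set set \<Rightarrow> bool" where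
  "planar n \<alpha> \<longleftrightarrow>
     \<not> (\<exists>A\<in>\<alpha>. \<exists>B\<in>\<alpha>. A \<noteq> B \<and>
          (\<exists>a\<in>A. \<exists>b\<in>B. \<exists>c\<in>A. \<exists>d\<in>B.
             cyc_pos n a < cyc_pos n b \<and> cyc_pos n b < cyc_pos n c \<and> cyc_pos n c < cyc_pos n d))"

definition temperley_lieb :: "nat \<Rightarrow> vertex set set set" where
  "temperley_lieb n = {\<alpha> \<in> partition_monoid n. planar n \<alpha> \<and> (\<forall>B\<in>\<alpha>. card B = 2)}"

definition is_projection :: "nat \<Rightarrow> vertex set set \<Rightarrow> bool" where
  "is_projection n \<epsilon> \<longleftrightarrow> pprod n \<epsilon> \<epsilon> = \<epsilon> \<and> pstar \<epsilon> = \<epsilon>"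

definition TL_projections :: "nat \<Rightarrow> nat \<Rightarrow> vertex set set set" where
  "TL_projections n r = {\<epsilon> \<in> temperley_lieb n. is_projection n \<epsilon> \<and> prank n \<epsilon> = r}"

definition Q_TL :: "nat \<Rightarrow> vertex set set set" where
  "Q_TL n =
     (if even n then TL_projections n 0 \<union> TL_projections n 2 \<union> TL_projections n 4
      else TL_projections n 1 \<union> TL_projections n 3)"

definition catalan :: "nat \<Rightarrow> real" where
  "catalan m = 1 / real (m + 1) * real ((2 * m) choose m)"

end

theory Submission
  imports Defs
begin

text \<open>
  By planarity every transversal of a *-symmetric element of \<open>TL\<^sub>n\<close> is vertical, so the element
  is determined by its upper half, and it is then automatically idempotent. Let \<open>N n r\<close> be the
  number of upper halves with \<open>r\<close> transversals. Deleting the last point, after cutting its arc if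
  there is one, gives \<open>N (n + 1) r = N n (r - 1) + N n (r + 1)\<close>; the inverse of a cut is forced,
  since the last point can only be joined to the rightmost transversal. The recurrence yields
  \<open>N (2 * k) 0 = C k\<close>, and applied a few more times it expresses the values with \<open>r \<le> 4\<close>
  through Catalan numbers.
\<close>

section \<open>Half diagrams\<close>

text \<open>
  The involution \<open>p\<close> encodes the upper half of a diagram: \<open>p x \<noteq> x\<close> means that \<open>x\<close> is joined
  to \<open>p x\<close>, and a fixed point in \<open>{1..n}\<close> is the end of a transversal. The last condition says
  both that arcs do not cross and that no transversal starts below an arc.
\<close>

definition half_diagram :: "nat \<Rightarrow> (nat \<Rightarrow> nat) \<Rightarrow> bool" where
  "half_diagram n p \<longleftrightarrow>
     (\<forall>x. p (p x) = x) \<and> (\<forall>x. x \<notin> {1..n} \<longrightarrow> p x = x) \<and>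
     (\<forall>x y. x < y \<longrightarrow> y < p x \<longrightarrow> p y \<noteq> y \<and> x < p y \<and> p y < p x)"

definition fixed_points :: "nat \<Rightarrow> (nat \<Rightarrow> nat) \<Rightarrow> nat set" where
  "fixed_points n p = {x \<in> {1..n}. p x = x}"

definition half_diagrams :: "nat \<Rightarrow> nat \<Rightarrow> (nat \<Rightarrow> nat) set" where
  "half_diagrams n r = {p. half_diagram n p \<and> card (fixed_points n p) = r}"

text \<open>Only the rightmost transversal can be joined to \<open>Suc n\<close>; with any other
  choice a transversal would remain under the new arc. The value is meaningful only if
  \<open>fixed_points n p\<close> is nonempty.\<close>

definition join_last :: "nat \<Rightarrow> (nat \<Rightarrow> nat) \<Rightarrow> nat \<Rightarrow> nat" where
  "join_last n p = p(Max (fixed_points n p) := Suc n, Suc n := Max (fixed_points n p))"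

lemma finite_fixed_points [simp]: "finite (fixed_points n p)"
  by (simp add: fixed_points_def)

lemma half_diagramD:
  assumes "half_diagram n p"
  shows "p (p x) = x" "x \<notin> {1..n} \<Longrightarrow> p x = x"
    "x < y \<Longrightarrow> y < p x \<Longrightarrow> p y \<noteq> y" "x < y \<Longrightarrow> y < p x \<Longrightarrow> x < p y" "x < y \<Longrightarrow> y < p x \<Longrightarrow> p y < p x"
  using assms unfolding half_diagram_def by blast+

lemma half_diagram_in_range:
  assumes "half_diagram n p" "x \<in> {1..n}"
  shows "p x \<in> {1..n}"
  using half_diagramD(1,2)[OF assms(1)] assms(2) by metis

section \<open>Adding and deleting the last point\<close>

lemma half_diagram_Suc_iff:
  "half_diagram (Suc n) p \<and> p (Suc n) = Suc n \<longleftrightarrow> half_diagram n p"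
proof
  assume p: "half_diagram (Suc n) p \<and> p (Suc n) = Suc n"
  then have "p x = x" if "x \<notin> {1..n}" for x
    using that half_diagramD(2)[of "Suc n" p x] by (cases "x = Suc n") auto
  with p show "half_diagram n p"
    by (auto simp: half_diagram_def)
next
  assume "half_diagram n p"
  then show "half_diagram (Suc n) p \<and> p (Suc n) = Suc n"
    by (auto simp: half_diagram_def)
qed

lemma fixed_points_Suc:
  "fixed_points (Suc n) p =
     (if p (Suc n) = Suc n then insert (Suc n) (fixed_points n p) else fixed_points n p)"
  by (auto simp: fixed_points_def le_Suc_eq)

lemma card_fixed_points_Suc:
  "card (fixed_points (Suc n) p) =
     (if p (Suc n) = Suc n then Suc (card (fixed_points n p)) else card (fixed_points n p))"
  by (auto simp: fixed_points_Suc) (simp add: fixed_points_def)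

text \<open>No arc passes over the rightmost transversal \<open>m\<close>, so the points to its
  right are paired among themselves. The new arc from \<open>m\<close> to \<open>Suc n\<close>
  therefore encloses only complete arcs.\<close>

lemma join_last:
  assumes "half_diagram n p" "fixed_points n p \<noteq> {}"
  shows "half_diagram (Suc n) (join_last n p)"
    and "fixed_points (Suc n) (join_last n p) = fixed_points n p - {Max (fixed_points n p)}"
    and "join_last n p (Suc n) = Max (fixed_points n p)"
    and "Max (fixed_points n p) \<in> fixed_points n p"
proof -
  define m where "m = Max (fixed_points n p)"
  have m: "m \<in> fixed_points n p"
    unfolding m_def using assms(2) by (intro Max_in) auto
  have max: "x \<le> m" if "x \<in> fixed_points n p" for x
    unfolding m_def using that by simp
  have mn: "m \<in> {1..n}" "p m = m" using m by (auto simp: fixed_points_def)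
  have above: "p y \<noteq> y" if "m < y" "y \<le> n" for y
    using max[of y] that by (auto simp: fixed_points_def)
  have pm: "p x = m \<longleftrightarrow> x = m" for x
    using half_diagramD(1)[OF assms(1)] mn by metis
  have pn: "p x = Suc n \<longleftrightarrow> x = Suc n" for x
    using half_diagramD(1)[OF assms(1)] half_diagramD(2)[OF assms(1), of "Suc n"]
    by (metis atLeastAtMost_iff not_less_eq_eq order_refl)
  have below: "p y \<le> n" if "y \<le> n" for y
    using half_diagram_in_range[OF assms(1), of y] half_diagramD(2)[OF assms(1), of y] that
    by (cases "y \<in> {1..n}") auto
  \<comment> \<open>An arc from a point right of \<open>m\<close> to one left of \<open>m\<close>
    would have the transversal \<open>m\<close> below it.\<close>
  have side: "m < p y" if "m < y" "y \<le> n" for y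
  proof (rule ccontr)
    assume "\<not> m < p y"
    then have "p y < m" using pm[of y] that by (auto simp: not_less le_less)
    with half_diagramD(3)[OF assms(1), of "p y" m] half_diagramD(1)[OF assms(1)] mn that
    show False by auto
  qed
  let ?q = "p(m := Suc n, Suc n := m)"
  have q: "join_last n p = ?q" by (simp add: join_last_def m_def)
  have nc: "?q y \<noteq> y \<and> x < ?q y \<and> ?q y < ?q x" if xy: "x < y" "y < ?q x" for x y
  proof (cases "x = m")
    case True
    then have "m < y" "y \<le> n" using xy mn by auto
    then show ?thesis using True above[of y] side[of y] below[of y] mn by auto
  next
    case False
    \<comment> \<open>What remains is an arc of \<open>p\<close> itself. It covers neither
      \<open>m\<close>, a transversal of \<open>p\<close>, nor \<open>Suc n\<close>, so the change
      of \<open>p\<close> at these two points is invisible below it.\<close>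
    have "x \<noteq> Suc n" using xy mn by auto
    with False xy have *: "x < y" "y < p x" by auto
    have "y \<noteq> m" using half_diagramD(3)[OF assms(1) *] mn by auto
    moreover have "p x \<le> n" using below[of x] \<open>x \<noteq> Suc n\<close> half_diagramD(2)[OF assms(1), of x] *
      by (cases "x \<le> n") auto
    then have "y \<noteq> Suc n" using * by auto
    ultimately show ?thesis
      using half_diagramD(3-5)[OF assms(1) *] False \<open>x \<noteq> Suc n\<close> by auto
  qed
  have inv: "?q (?q x) = x" for x
    using mn half_diagramD(1)[OF assms(1)] by (auto simp: pm pn)
  have out: "?q x = x" if "x \<notin> {1..Suc n}" for x
    using half_diagramD(2)[OF assms(1), of x] that mn by auto
  show "half_diagram (Suc n) (join_last n p)"
    unfolding q half_diagram_def using nc inv out by blast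
  show "fixed_points (Suc n) (join_last n p) = fixed_points n p - {Max (fixed_points n p)}"
    unfolding q m_def[symmetric] using mn by (auto simp: fixed_points_def)
  show "join_last n p (Suc n) = Max (fixed_points n p)"
    by (simp add: join_last_def)
  show "Max (fixed_points n p) \<in> fixed_points n p"
    using m m_def by simp
qed

text \<open>Cutting the arc at \<open>Suc n\<close> leaves two free ends. The one at
  \<open>Suc n\<close> drops out of the range, and the one at \<open>m = p (Suc n)\<close> becomes
  the rightmost transversal, so \<open>join_last\<close> restores the arc.\<close>

lemma half_diagram_cut_last:
  assumes p: "half_diagram (Suc n) p" "p (Suc n) \<noteq> Suc n"
  defines "q \<equiv> p(p (Suc n) := p (Suc n), Suc n := Suc n)"
  shows "half_diagram n q" "fixed_points n q = insert (p (Suc n)) (fixed_points (Suc n) p)"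
    "p (Suc n) \<notin> fixed_points (Suc n) p" "join_last n q = p"
proof -
  define m where "m = p (Suc n)"
  have pm: "p m = Suc n" using half_diagramD(1)[OF p(1)] by (simp add: m_def)
  have mn: "m \<in> {1..n}"
    using half_diagram_in_range[OF p(1), of "Suc n"] p(2) by (auto simp: m_def)
  have q: "q = p(m := m, Suc n := Suc n)" by (simp add: q_def m_def)
  have inv: "q (q x) = x" for x
    using mn pm half_diagramD(1)[OF p(1)] unfolding q by (auto simp: m_def; metis)
  have out: "q x = x" if "x \<notin> {1..n}" for x
    using half_diagramD(2)[OF p(1), of x] that by (auto simp: q)
  have nc: "q y \<noteq> y \<and> x < q y \<and> q y < q x" if xy: "x < y" "y < q x" for x y
  proof -
    have x: "x \<noteq> m" "x \<noteq> Suc n" using xy mn by (auto simp: q)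
    with xy have *: "x < y" "y < p x" by (auto simp: q)
    note h = half_diagramD(3-5)[OF p(1) *]
    have "p x \<noteq> Suc n" using half_diagramD(1)[OF p(1), of x] x by (auto simp: m_def)
    then have "p x \<le> n"
      using half_diagram_in_range[OF p(1), of x] half_diagramD(2)[OF p(1), of x] *
      by (cases "x \<in> {1..Suc n}") auto
    \<comment> \<open>An arc over \<open>m\<close> would also lie over its partner
      \<open>Suc n\<close>, beyond which there is no point.\<close>
    then have "y \<noteq> Suc n" "y \<noteq> m" using * h pm by auto
    then show ?thesis using h x by (auto simp: q)
  qed
  show "half_diagram n q" unfolding half_diagram_def using inv out nc by blast
  show fps: "fixed_points n q = insert (p (Suc n)) (fixed_points (Suc n) p)"
    using mn p(2) pm unfolding m_def[symmetric] by (auto simp: fixed_points_def q le_Suc_eq m_def)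
  show "p (Suc n) \<notin> fixed_points (Suc n) p"
    using pm p(2) by (auto simp: fixed_points_def m_def)
  \<comment> \<open>The points strictly between \<open>m\<close> and \<open>Suc n\<close> lie under
    the cut arc, so none of them is a transversal.\<close>
  have "x \<le> m" if "x \<in> fixed_points (Suc n) p" for x
    using half_diagramD(3)[OF p(1), of m x] pm that p(2)
    by (force simp: fixed_points_def le_Suc_eq)
  then have "Max (fixed_points n q) = m"
    unfolding fps by (intro Max_eqI) (auto simp: m_def)
  then show "join_last n q = p"
    using pm by (auto simp: join_last_def q m_def)
qed

text \<open>The last point is either a transversal or the right end of an arc. The guard at
  \<open>r = 0\<close> is essential: truncated subtraction would otherwise count
  \<open>half_diagrams n 0\<close>.\<close>

lemma half_diagrams_Suc:
  "half_diagrams (Suc n) r =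
     (if r = 0 then {} else half_diagrams n (r - 1)) \<union> join_last n ` half_diagrams n (Suc r)"
proof (intro set_eqI iffI)
  fix p assume p: "p \<in> half_diagrams (Suc n) r"
  show "p \<in> (if r = 0 then {} else half_diagrams n (r - 1)) \<union> join_last n ` half_diagrams n (Suc r)"
  proof (cases "p (Suc n) = Suc n")
    case True
    \<comment> \<open>Deleting a final transversal does not change the function, since half diagrams
      are the identity outside their range.\<close>
    then show ?thesis
      using p half_diagram_Suc_iff[of n p]
      by (auto simp: half_diagrams_def card_fixed_points_Suc)
  next
    case False
    have "half_diagram (Suc n) p" using p by (simp add: half_diagrams_def)
    note h = half_diagram_cut_last[OF this False]
    show ?thesis
      by (rule UnI2, rule image_eqI[where f = "join_last n", OF h(4)[symmetric]])
        (use h(1-3) p in \<open>simp add: half_diagrams_def\<close>)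
  qed
next
  fix p assume "p \<in> (if r = 0 then {} else half_diagrams n (r - 1)) \<union> join_last n ` half_diagrams n (Suc r)"
  then consider "r \<noteq> 0" "p \<in> half_diagrams n (r - 1)"
    | q where "q \<in> half_diagrams n (Suc r)" "p = join_last n q"
    by (auto split: if_splits)
  then show "p \<in> half_diagrams (Suc n) r"
  proof cases
    case 1
    then show ?thesis
      using half_diagram_Suc_iff[of n p] by (auto simp: half_diagrams_def card_fixed_points_Suc)
  next
    case 2
    then have "half_diagram n q" "fixed_points n q \<noteq> {}" by (auto simp: half_diagrams_def)
    note h = join_last[OF this]
    show ?thesis using h 2 by (simp add: half_diagrams_def)
  qed
qed

lemma inj_on_join_last: "inj_on (join_last n) (half_diagrams n (Suc r))"
proof -
  \<comment> \<open>The right-hand side is the cut of \<open>join_last n q\<close>, so cutting is a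
    left inverse.\<close>
  have "q = (join_last n q)(join_last n q (Suc n) := join_last n q (Suc n), Suc n := Suc n)"
    if q: "q \<in> half_diagrams n (Suc r)" for q
  proof -
    have h: "half_diagram n q" "fixed_points n q \<noteq> {}" using q by (auto simp: half_diagrams_def)
    then have "q (Max (fixed_points n q)) = Max (fixed_points n q)" "q (Suc n) = Suc n"
      using join_last(4)[OF h] half_diagramD(2)[OF h(1), of "Suc n"]
      by (auto simp: fixed_points_def)
    then show ?thesis by (auto simp: join_last_def)
  qed
  then show ?thesis by (metis inj_onI)
qed

section \<open>Counting half diagrams\<close>

lemma half_diagrams_0: "half_diagrams 0 r = (if r = 0 then {id} else {})"
  by (auto simp: half_diagrams_def half_diagram_def fixed_points_def)

lemma finite_half_diagrams [simp]: "finite (half_diagrams n r)"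
  by (induction n arbitrary: r) (auto simp: half_diagrams_0 half_diagrams_Suc)

lemma card_half_diagrams_Suc:
  "card (half_diagrams (Suc n) r) =
     (if r = 0 then 0 else card (half_diagrams n (r - 1))) + card (half_diagrams n (Suc r))"
proof -
  have "p \<notin> join_last n ` half_diagrams n (Suc r)" if "p \<in> half_diagrams n (r - 1)" for p
  proof
    assume "p \<in> join_last n ` half_diagrams n (Suc r)"
    then obtain q where q: "q \<in> half_diagrams n (Suc r)" "p = join_last n q" by auto
    then have h: "half_diagram n q" "fixed_points n q \<noteq> {}" by (auto simp: half_diagrams_def)
    have "p (Suc n) \<noteq> Suc n" using join_last(3,4)[OF h] q by (auto simp: fixed_points_def)
    then show False using that half_diagramD(2)[of n p "Suc n"] by (auto simp: half_diagrams_def)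
  qed
  then have "(if r = 0 then {} else half_diagrams n (r - 1)) \<inter> join_last n ` half_diagrams n (Suc r) = {}"
    by auto
  then show ?thesis
    unfolding half_diagrams_Suc
    by (subst card_Un_disjoint) (auto simp: card_image inj_on_join_last)
qed

lemma half_diagrams_empty: "n < r \<Longrightarrow> half_diagrams n r = {}"
  by (induction n arbitrary: r) (auto simp: half_diagrams_0 half_diagrams_Suc)

text \<open>These are the ballot numbers, with \<open>j\<close> the number of arcs. Induction on the
  number of points covers both terms of the recurrence, which have parameters
  \<open>(r - 1, j)\<close> and \<open>(r + 1, j - 1)\<close>.\<close>

lemma card_half_diagrams:
  "real (card (half_diagrams (r + 2 * j) r)) =
     real (r + 1) / real (r + j + 1) * real ((r + 2 * j) choose j)"
proof (induction "r + 2 * j" arbitrary: r j)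
  case 0
  then show ?case by (simp add: half_diagrams_0)
next
  case (Suc n)
  \<comment> \<open>Both terms of the recurrence are rewritten as rational multiples of this one
    binomial coefficient.\<close>
  define c where "c = real (Suc n choose j)"
  have first: "real (if r = 0 then 0 else card (half_diagrams n (r - 1))) =
      real r / real (r + j) * real (n choose j)"
  proof (cases r)
    case (Suc s)
    then show ?thesis using Suc.hyps(1)[of s j] Suc.hyps(2) by simp
  qed simp
  have absorb: "real (n choose j) = real (r + j) / real (Suc n) * c"
  proof -
    have "(Suc n - j) * (Suc n choose j) = Suc n * (n choose j)"
      using binomial_absorb_comp[of "Suc n" j] by simp
    moreover have "Suc n - j = r + j" using Suc.hyps(2) by simp
    ultimately have "real (r + j) * c = real (Suc n) * real (n choose j)"
      unfolding c_def by (metis of_nat_mult)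
    then show ?thesis by (simp add: field_simps)
  qed
  have second: "real (card (half_diagrams n (Suc r))) =
      real (r + 2) / real (r + j + 1) * (real j / real (Suc n) * c)"
  proof (cases j)
    case 0
    \<comment> \<open>Without arcs \<open>Suc n = r\<close>, so \<open>Suc r\<close> transversals do
      not fit on \<open>n\<close> points and both sides vanish.\<close>
    then show ?thesis using Suc.hyps(2) by (simp add: half_diagrams_empty)
  next
    case (Suc i)
    have "Suc i * (Suc n choose Suc i) = Suc n * (n choose i)"
      by (rule Suc_times_binomial)
    then have "real (Suc i) * c = real (Suc n) * real (n choose i)"
      unfolding c_def Suc by (metis of_nat_mult)
    then have "real (n choose i) = real j / real (Suc n) * c"
      by (simp add: Suc field_simps)
    moreover have "n = Suc r + 2 * i" using Suc.hyps(2) Suc by simp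
    ultimately show ?thesis
      using Suc.hyps(1)[of "Suc r" i] Suc by (simp add: ac_simps)
  qed
  have pos: "r + j \<noteq> 0" using Suc.hyps(2) by auto
  have n: "real (Suc n) = real r + 2 * real j" using Suc.hyps(2) by simp
  have "real (card (half_diagrams (Suc n) r)) =
      real r / real (Suc n) * c + real (r + 2) / real (r + j + 1) * (real j / real (Suc n) * c)"
    unfolding card_half_diagrams_Suc of_nat_add first second absorb using pos by simp
  also have "\<dots> = real (r + 1) / real (r + j + 1) * c"
  proof -
    have "a / A * c + d / B * (b / A * c) = (a * B + d * b) / (A * B) * c"
      if "A \<noteq> 0" "B \<noteq> 0" for a b d A B :: real
      using that by (simp add: field_simps)
    \<comment> \<open>Over the common denominator the numerator contains the factor
      \<open>Suc n = r + 2 * j\<close>, which cancels.\<close>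
    moreover have "real r * real (r + j + 1) + real (r + 2) * real j = real (Suc n) * real (r + 1)"
      unfolding n by (simp add: algebra_simps)
    ultimately show ?thesis by simp
  qed
  finally show ?case using Suc.hyps(2) by (simp add: c_def)
qed

section \<open>Projections of the Temperley--Lieb monoid\<close>

fun partner :: "(nat \<Rightarrow> nat) \<Rightarrow> vertex \<Rightarrow> vertex" where
  "partner p (Upper x) = (if p x = x then Lower x else Upper (p x))"
| "partner p (Lower x) = (if p x = x then Upper x else Lower (p x))"
| "partner p (Middle x) = Middle x"

definition diagram :: "nat \<Rightarrow> (nat \<Rightarrow> nat) \<Rightarrow> vertex set set" where
  "diagram n p = (\<lambda>v. {v, partner p v}) ` vertices n"

lemma Upper_in_vertices [simp]: "Upper x \<in> vertices n \<longleftrightarrow> x \<in> {1..n}"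
  and Lower_in_vertices [simp]: "Lower x \<in> vertices n \<longleftrightarrow> x \<in> {1..n}"
  and Middle_in_vertices [simp]: "Middle x \<notin> vertices n"
  by (auto simp: vertices_def upper_row_def lower_row_def)

lemma Upper_in_upper_row [simp]: "Upper x \<in> upper_row n \<longleftrightarrow> x \<in> {1..n}"
  and Lower_in_upper_row [simp]: "Lower x \<notin> upper_row n"
  and Upper_in_lower_row [simp]: "Upper x \<notin> lower_row n"
  and Lower_in_lower_row [simp]: "Lower x \<in> lower_row n \<longleftrightarrow> x \<in> {1..n}"
  by (auto simp: upper_row_def lower_row_def)

lemma vertices_cases:
  assumes "v \<in> vertices n"
  obtains (Upper) x where "v = Upper x" "x \<in> {1..n}" | (Lower) x where "v = Lower x" "x \<in> {1..n}"
  using assms by (cases v) auto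

lemma flip_flip [simp]: "flip (flip v) = v"
  by (cases v) auto

lemma flip_in_vertices [simp]: "flip v \<in> vertices n \<longleftrightarrow> v \<in> vertices n"
  by (cases v) auto

lemma flip_image_vertices [simp]: "flip ` vertices n = vertices n"
proof (intro set_eqI iffI)
  fix v assume "v \<in> vertices n"
  then show "v \<in> flip ` vertices n" by (intro image_eqI[of _ _ "flip v"]) simp_all
qed auto

lemma partner_flip: "partner p (flip v) = flip (partner p v)"
  by (cases v) auto

lemma partner_in_vertices:
  assumes "half_diagram n p" "v \<in> vertices n"
  shows "partner p v \<in> vertices n"
  using assms(2) half_diagram_in_range[OF assms(1)] by (cases v) auto

lemma partner_partner:
  assumes "half_diagram n p"
  shows "partner p (partner p v) = v"
  by (cases v) (auto simp: half_diagramD(1)[OF assms])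

lemma partner_neq: "v \<in> vertices n \<Longrightarrow> partner p v \<noteq> v"
  by (cases v) auto

text \<open>Each block arises from both of its vertices; since \<open>partner p\<close> is an
  involution, it can be named from whichever one is at hand.\<close>

lemma mem_diagram_iff:
  assumes "half_diagram n p" "v \<in> vertices n" "v \<in> B"
  shows "B \<in> diagram n p \<longleftrightarrow> B = {v, partner p v}"
proof
  assume "B \<in> diagram n p"
  then obtain u where "B = {u, partner p u}" by (auto simp: diagram_def)
  with assms(3) partner_partner[OF assms(1), of u] show "B = {v, partner p v}" by auto
next
  assume "B = {v, partner p v}"
  with assms(2) show "B \<in> diagram n p" by (simp add: diagram_def)
qed

section \<open>Every half diagram yields a Temperley-Lieb projection\<close>

lemma partition_on_diagram:
  assumes "half_diagram n p"
  shows "partition_on (vertices n) (diagram n p)"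
proof (rule partition_onI)
  show "\<Union>(diagram n p) = vertices n"
    using partner_in_vertices[OF assms] by (auto simp: diagram_def)
  show "disjnt A B" if "A \<in> diagram n p" "B \<in> diagram n p" "A \<noteq> B" for A B
  proof (rule ccontr)
    assume "\<not> disjnt A B"
    then obtain v where v: "v \<in> A" "v \<in> B" by (auto simp: disjnt_def)
    then have "v \<in> vertices n" using that partner_in_vertices[OF assms] by (auto simp: diagram_def)
    then show False using v that mem_diagram_iff[OF assms] by metis
  qed
  show "{} \<notin> diagram n p"
    by (auto simp: diagram_def)
qed

lemma pstar_diagram: "pstar (diagram n p) = diagram n p"
proof -
  have "diagram n p = (\<lambda>v. {v, partner p v}) ` flip ` vertices n"
    by (simp add: diagram_def)
  also have "\<dots> = pstar (diagram n p)"
    unfolding image_image partner_flip by (simp add: pstar_def diagram_def image_image)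
  finally show ?thesis by simp
qed

lemma planar_diagram:
  assumes "half_diagram n p"
  shows "planar n (diagram n p)"
proof -
  note h = half_diagramD[OF assms]
  have nc: False
    if v: "v \<in> vertices n" "w \<in> vertices n" and
      lt: "cyc_pos n v < cyc_pos n w" "cyc_pos n w < cyc_pos n (partner p v)"
        "cyc_pos n (partner p v) < cyc_pos n (partner p w)" for v w
  proof -
    show False
      using v(1)
    proof (cases rule: vertices_cases)
      case (Upper x)
      show False
        using v(2)
      proof (cases rule: vertices_cases)
        case y: (Upper y)
        show ?thesis
          using lt Upper y h(3-5)[of x y] half_diagram_in_range[OF assms, of y]
          by (auto split: if_splits)
      next
        case y: (Lower y)
        \<comment> \<open>To end after \<open>w\<close> on the boundary, the block of
          \<open>v\<close> must be a transversal at \<open>x\<close>, which would then lie under the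
          arc from \<open>p y\<close> to \<open>y\<close>.\<close>
        have "p y \<noteq> y \<and> p y < x \<and> x < y \<and> p x = x"
          using lt Upper y half_diagram_in_range[OF assms, of x] half_diagram_in_range[OF assms, of y]
          by (auto split: if_splits)
        then show ?thesis using h(3)[of "p y" x] h(1)[of y] by auto
      qed
    next
      case (Lower x)
      show False
        using v(2)
      proof (cases rule: vertices_cases)
        case y: (Upper y)
        then show ?thesis using lt(1) Lower by auto
      next
        case y: (Lower y)
        \<comment> \<open>Positions decrease along the lower row, so the inequalities reverse and
          give two crossing arcs of \<open>p\<close>.\<close>
        have "p x < y \<and> y < x \<and> p y < p x"
          using lt Lower y half_diagram_in_range[OF assms, of x] half_diagram_in_range[OF assms, of y]
          by (auto split: if_splits)
        then show ?thesis using h(4)[of "p x" y] h(1)[of x] by auto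
      qed
    qed
  qed
  show ?thesis
    unfolding planar_def
  proof (intro notI, elim bexE conjE)
    fix A B a b c d
    assume AB: "A \<in> diagram n p" "B \<in> diagram n p" "a \<in> A" "b \<in> B" "c \<in> A" "d \<in> B"
      and lt: "cyc_pos n a < cyc_pos n b" "cyc_pos n b < cyc_pos n c" "cyc_pos n c < cyc_pos n d"
    have V: "a \<in> vertices n" "b \<in> vertices n"
      using partition_onD1[OF partition_on_diagram[OF assms]] AB by auto
    have "c = partner p a" "d = partner p b"
      using AB lt mem_diagram_iff[OF assms V(1), of A] mem_diagram_iff[OF assms V(2), of B] by auto
    then show False using nc[OF V] lt by simp
  qed
qed

lemma diagram_in_temperley_lieb:
  assumes "half_diagram n p"
  shows "diagram n p \<in> temperley_lieb n"
proof -
  have "card {v, partner p v} = 2" if "v \<in> vertices n" for v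
    using partner_neq[OF that, of p] by simp
  then have "\<forall>B\<in>diagram n p. card B = 2" by (simp add: diagram_def)
  with partition_on_diagram[OF assms] planar_diagram[OF assms] show ?thesis
    by (simp add: temperley_lieb_def partition_monoid_def)
qed

text \<open>
  The component of a vertex in the product graph of \<open>diagram n p\<close> with itself, with the
  components of transversals labelled by their upper end.
\<close>

fun component :: "(nat \<Rightarrow> nat) \<Rightarrow> vertex \<Rightarrow> vertex set" where
  "component p (Upper x) = {Upper x, Upper (p x)}"
| "component p (Middle x) = (if p x = x then {Upper x} else {Middle x, Middle (p x)})"
| "component p (Lower x) = (if p x = x then {Upper x} else {Lower x, Lower (p x)})"

text \<open>By mirror symmetry both copies contribute the same arcs to the middle row. These close
  up into two-point components, while transversals continue vertically. Hence
  \<open>component\<close> is constant along edges, and on the outer rows it separates any two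
  vertices that are not partners.\<close>

lemma pprod_diagram:
  assumes "half_diagram n p"
  shows "pprod n (diagram n p) (diagram n p) = diagram n p"
proof -
  note inv = half_diagramD(1)[OF assms]
  \<comment> \<open>\<open>l v\<close> and \<open>u v\<close> are the renamed blocks of
    \<open>v\<close> in the first and in the second factor.\<close>
  define l where "l v = {lower_to_middle v, lower_to_middle (partner p v)}" for v
  define u where "u v = {upper_to_middle v, upper_to_middle (partner p v)}" for v
  define R where "R = (\<Union>v\<in>vertices n. l v \<times> l v) \<union> (\<Union>v\<in>vertices n. u v \<times> u v)"
  have R: "product_equiv (diagram n p) (diagram n p) = R\<^sup>+"
    by (simp add: product_equiv_def generated_equiv_def R_def l_def u_def diagram_def image_image UN_Un)
  have const: "component p (lower_to_middle (partner p v)) = component p (lower_to_middle v)"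
    "component p (upper_to_middle (partner p v)) = component p (upper_to_middle v)" for v
    by (cases v; simp add: inv insert_commute; fail)+
  have step: "component p v = component p w" if "(v, w) \<in> R" for v w
    using that by (auto simp: R_def l_def u_def const)
  have invariant: "component p v = component p w" if "(v, w) \<in> R\<^sup>+" for v w
    using that by induction (use step in auto)
  have separates: "w = v \<or> w = partner p v"
    if "component p v = component p w" "v \<in> vertices n" "w \<in> vertices n" for v w
    using that(2)
  proof (cases rule: vertices_cases)
    case v: (Upper x)
    show ?thesis
      using that(3) by (cases rule: vertices_cases)
        (use that(1) v in \<open>auto simp: doubleton_eq_iff split: if_splits\<close>)
  next
    case v: (Lower x)
    show ?thesis
      using that(3) by (cases rule: vertices_cases)
        (use that(1) v in \<open>auto simp: doubleton_eq_iff split: if_splits\<close>)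
  qed
  have R_l: "(lower_to_middle v, lower_to_middle w) \<in> R"
    and R_u: "(upper_to_middle v, upper_to_middle w) \<in> R"
    if "v \<in> vertices n" "w \<in> {v, partner p v}" for v w
    using that unfolding R_def l_def u_def by blast+
  have connected: "(v, w) \<in> R\<^sup>+" if v: "v \<in> vertices n" and w: "w \<in> {v, partner p v}" for v w
    using v
  proof (cases rule: vertices_cases)
    case (Upper x)
    show ?thesis
    proof (cases "w = Lower x")
      case True
      \<comment> \<open>A transversal is traversed through \<open>Middle x\<close>, with one edge
        from each factor.\<close>
      then show ?thesis
        using R_l[OF that] R_u[OF that] Upper by (auto intro: trancl_into_trancl)
    next
      case False
      then have "lower_to_middle w = w" using w Upper by (auto split: if_splits)
      then show ?thesis using R_l[OF that] Upper by auto
    qed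
  next
    case (Lower x)
    show ?thesis
    proof (cases "w = Upper x")
      case True
      then show ?thesis
        using R_l[OF that] R_u[OF that] Lower by (auto intro: trancl_into_trancl)
    next
      case False
      then have "upper_to_middle w = w" using w Lower by (auto split: if_splits)
      then show ?thesis using R_u[OF that] Lower by auto
    qed
  qed
  have "(product_equiv (diagram n p) (diagram n p) \<inter> vertices n \<times> vertices n) `` {v} =
      {v, partner p v}" if v: "v \<in> vertices n" for v
  proof (intro set_eqI iffI)
    fix w assume "w \<in> (product_equiv (diagram n p) (diagram n p) \<inter> vertices n \<times> vertices n) `` {v}"
    then show "w \<in> {v, partner p v}"
      using separates[OF invariant v] by (auto simp: R)
  next
    fix w assume w: "w \<in> {v, partner p v}"
    then have "w \<in> vertices n" using v partner_in_vertices[OF assms v] by blast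
    then show "w \<in> (product_equiv (diagram n p) (diagram n p) \<inter> vertices n \<times> vertices n) `` {v}"
      using connected[OF v w] v by (simp add: R)
  qed
  then show ?thesis
    by (auto simp: pprod_def quotient_def diagram_def)
qed

lemma prank_diagram:
  assumes "half_diagram n p"
  shows "prank n (diagram n p) = card (fixed_points n p)"
proof -
  have "{B \<in> diagram n p. B \<inter> upper_row n \<noteq> {} \<and> B \<inter> lower_row n \<noteq> {}} =
      (\<lambda>x. {Upper x, Lower x}) ` fixed_points n p"
  proof (intro set_eqI iffI)
    fix B assume "B \<in> {B \<in> diagram n p. B \<inter> upper_row n \<noteq> {} \<and> B \<inter> lower_row n \<noteq> {}}"
    then obtain v where "v \<in> vertices n" "B = {v, partner p v}"
      "B \<inter> upper_row n \<noteq> {}" "B \<inter> lower_row n \<noteq> {}" by (auto simp: diagram_def)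
    then show "B \<in> (\<lambda>x. {Upper x, Lower x}) ` fixed_points n p"
      by (cases v) (auto simp: fixed_points_def split: if_splits)
  next
    fix B assume "B \<in> (\<lambda>x. {Upper x, Lower x}) ` fixed_points n p"
    then obtain x where x: "x \<in> {1..n}" "p x = x" "B = {Upper x, Lower x}"
      by (auto simp: fixed_points_def)
    then show "B \<in> {B \<in> diagram n p. B \<inter> upper_row n \<noteq> {} \<and> B \<inter> lower_row n \<noteq> {}}"
      using mem_diagram_iff[OF assms, of "Upper x" B] by auto
  qed
  moreover have "inj_on (\<lambda>x. {Upper x, Lower x}) (fixed_points n p)"
    by (auto simp: inj_on_def doubleton_eq_iff)
  ultimately show ?thesis by (simp add: prank_def card_image)
qed

lemma inj_on_diagram: "inj_on (diagram n) {p. half_diagram n p}"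
proof (rule inj_onI, rule ext, clarsimp)
  fix p q x
  assume h: "half_diagram n p" "half_diagram n q" and eq: "diagram n p = diagram n q"
  show "p x = q x"
  proof (cases "x \<in> {1..n}")
    case True
    then have "{Upper x, partner p (Upper x)} \<in> diagram n q"
      unfolding eq[symmetric] by (simp add: diagram_def del: partner.simps)
    then have "{Upper x, partner p (Upper x)} = {Upper x, partner q (Upper x)}"
      using mem_diagram_iff[OF h(2), of "Upper x" "{Upper x, partner p (Upper x)}"] True
      by (simp del: partner.simps)
    then show ?thesis by (auto simp: doubleton_eq_iff split: if_splits)
  next
    case False
    then show ?thesis using half_diagramD(2)[OF h(1)] half_diagramD(2)[OF h(2)] by simp
  qed
qed

section \<open>Symmetric Temperley-Lieb elements come from half diagrams\<close>

lemma doubleton_cancel: "{v, a} = {v, b} \<Longrightarrow> a = b"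
  by (auto simp: doubleton_eq_iff)

lemma partition_into_pairs:
  assumes "partition_on V \<alpha>" "\<forall>B\<in>\<alpha>. card B = 2"
  obtains P where "\<forall>v\<in>V. {v, P v} \<in> \<alpha> \<and> P v \<noteq> v \<and> P v \<in> V"
    "\<forall>B\<in>\<alpha>. \<forall>v\<in>B. B = {v, P v}"
proof -
  have "\<exists>w. {v, w} \<in> \<alpha> \<and> w \<noteq> v" if v: "v \<in> V" for v
  proof -
    obtain B where B: "B \<in> \<alpha>" "v \<in> B" using v partition_onD1[OF assms(1)] by auto
    obtain a b where ab: "B = {a, b}" "a \<noteq> b" using assms(2) B(1) by (meson card_2_iff)
    consider "v = a" | "v = b" using B ab by blast
    then show ?thesis
    proof cases
      case 1
      then show ?thesis using B ab by blast
    next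
      case 2
      then show ?thesis using B ab by (intro exI[of _ a]) (simp add: insert_commute)
    qed
  qed
  then obtain P where P: "\<And>v. v \<in> V \<Longrightarrow> {v, P v} \<in> \<alpha> \<and> P v \<noteq> v" by metis
  have V: "\<Union>\<alpha> = V" using partition_onD1[OF assms(1)] by simp
  have uniq: "B = {v, P v}" if "B \<in> \<alpha>" "v \<in> B" for v B
  proof (rule ccontr)
    assume "B \<noteq> {v, P v}"
    moreover have "{v, P v} \<in> \<alpha>" using P[of v] V that by blast
    ultimately have "B \<inter> {v, P v} = {}"
      using disjointD[OF partition_onD2[OF assms(1)] that(1)] by blast
    then show False using that by blast
  qed
  show ?thesis
  proof (rule that[of P])
    show "\<forall>v\<in>V. {v, P v} \<in> \<alpha> \<and> P v \<noteq> v \<and> P v \<in> V"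
      using P unfolding V[symmetric] by auto
    show "\<forall>B\<in>\<alpha>. \<forall>v\<in>B. B = {v, P v}"
      by (intro ballI uniq)
  qed
qed

text \<open>The blocks are the orbits of an involution \<open>P\<close> that commutes with
  \<open>flip\<close>. Once transversals are known to be vertical, \<open>P\<close> is determined by
  its action \<open>p\<close> on the upper row, and planarity becomes the nesting condition on
  \<open>p\<close>.\<close>

lemma symmetric_temperley_lieb_diagram:
  assumes \<alpha>: "\<alpha> \<in> temperley_lieb n" and star: "pstar \<alpha> = \<alpha>"
  obtains p where "half_diagram n p" "\<alpha> = diagram n p"
proof -
  have part: "partition_on (vertices n) \<alpha>" and two: "\<forall>B\<in>\<alpha>. card B = 2" and "planar n \<alpha>"
    using \<alpha> by (auto simp: temperley_lieb_def partition_monoid_def)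
  obtain P where P': "\<forall>v\<in>vertices n. {v, P v} \<in> \<alpha> \<and> P v \<noteq> v \<and> P v \<in> vertices n"
    "\<forall>B\<in>\<alpha>. \<forall>v\<in>B. B = {v, P v}"
    by (rule partition_into_pairs[OF part two])
  have P: "{v, P v} \<in> \<alpha>" "P v \<noteq> v" "P v \<in> vertices n" if "v \<in> vertices n" for v
    using P'(1) that by auto
  have block: "B = {v, P v}" if "B \<in> \<alpha>" "v \<in> B" for v B
    using P'(2) that by blast
  have PP: "P (P v) = v" if v: "v \<in> vertices n" for v
  proof -
    have "{P v, v} = {P v, P (P v)}"
      by (rule block) (use P(1)[OF v] in \<open>simp_all add: insert_commute\<close>)
    from doubleton_cancel[OF this] show ?thesis by (rule sym)
  qed
  have flip: "P (flip v) = flip (P v)" if v: "v \<in> vertices n" for v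
  proof -
    have "flip ` {v, P v} \<in> pstar \<alpha>" unfolding pstar_def using P(1)[OF v] by (rule imageI)
    then have "{flip v, flip (P v)} \<in> \<alpha>" by (simp add: star)
    then have "{flip v, flip (P v)} = {flip v, P (flip v)}" by (rule block) simp
    from doubleton_cancel[OF this] show ?thesis by (rule sym)
  qed
  have nc: False
    if v: "v \<in> vertices n" "w \<in> vertices n" and
      lt: "cyc_pos n v < cyc_pos n w" "cyc_pos n w < cyc_pos n (P v)" "cyc_pos n (P v) < cyc_pos n (P w)"
    for v w
  proof -
    have "v \<noteq> w" "v \<noteq> P w" using lt by auto
    then have "{v, P v} \<noteq> {w, P w}" by blast
    moreover have "\<exists>a\<in>{v, P v}. \<exists>b\<in>{w, P w}. \<exists>c\<in>{v, P v}. \<exists>d\<in>{w, P w}.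
        cyc_pos n a < cyc_pos n b \<and> cyc_pos n b < cyc_pos n c \<and> cyc_pos n c < cyc_pos n d"
      using lt by (intro bexI[of _ v] bexI[of _ w] bexI[of _ "P v"] bexI[of _ "P w"] conjI) simp_all
    ultimately have "\<not> planar n \<alpha>"
      unfolding planar_def not_not
      by (intro bexI[OF _ P(1)[OF v(1)]] bexI[OF _ P(1)[OF v(2)]] conjI)
    then show False using \<open>planar n \<alpha>\<close> by contradiction
  qed
  text \<open>A transversal \<open>{x, y'}\<close> with \<open>x < y\<close> would cross its mirror image \<open>{y, x'}\<close>.\<close>
  have less: "\<not> x < y" if "P (Upper x) = Lower y" "x \<in> {1..n}" "y \<in> {1..n}" for x y
  proof
    assume "x < y"
    have "P (Upper y) = Lower x"
      using flip[of "Lower y"] PP[of "Upper x"] that by simp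
    with \<open>x < y\<close> that show False by (intro nc[of "Upper x" "Upper y"]) auto
  qed
  have trans: "y = x" if xy: "P (Upper x) = Lower y" and x: "x \<in> {1..n}" for x y
  proof -
    have y: "y \<in> {1..n}" using P(3)[of "Upper x"] that by simp
    have "P (Upper y) = Lower x"
      using flip[of "Lower y"] PP[of "Upper x"] xy x y by simp
    then show ?thesis using less[OF xy x y] less[of y x] x y by auto
  qed
  \<comment> \<open>Transversal ends take the default branch and become fixed points. Outside
    \<open>{1..n}\<close> nothing is known about \<open>P\<close>, so every branch must return
    \<open>x\<close> there.\<close>
  define p where "p x = (case P (Upper x) of Upper y \<Rightarrow> if x \<in> {1..n} then y else x | _ \<Rightarrow> x)" for x
  have PU: "P (Upper x) = partner p (Upper x)" if x: "x \<in> {1..n}" for x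
  proof (cases "P (Upper x)")
    case (Upper y)
    then have "y \<noteq> x" using P(2)[of "Upper x"] x by auto
    then show ?thesis using Upper x by (simp add: p_def)
  next
    case (Lower y)
    then show ?thesis using trans[OF Lower x] by (simp add: p_def)
  next
    case (Middle y)
    then show ?thesis using P(3)[of "Upper x"] x by simp
  qed
  have Ppartner: "P v = partner p v" if "v \<in> vertices n" for v
    using that
  proof (cases rule: vertices_cases)
    case (Lower x)
    then show ?thesis using flip[of "Upper x"] PU[of x] partner_flip[of p "Upper x"] by simp
  qed (use PU in auto)
  have out: "p x = x" if "x \<notin> {1..n}" for x
    using that by (auto simp: p_def split: vertex.splits)
  have in_range: "p x \<in> {1..n}" if "x \<in> {1..n}" for x
    using P(3)[of "Upper x"] PU[OF that] that by (auto split: if_splits)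
  have inv: "p (p x) = x" for x
  proof (cases "x \<in> {1..n} \<and> p x \<noteq> x")
    case True
    then show ?thesis
      using PP[of "Upper x"] PU[of x] PU[of "p x"] in_range[of x] by (auto split: if_splits)
  qed (use out in auto)
  have "p y \<noteq> y \<and> x < p y \<and> p y < p x" if xy: "x < y" "y < p x" for x y
  proof -
    have x: "x \<in> {1..n}" using out[of x] xy by auto
    with in_range[OF x] xy have y: "y \<in> {1..n}" by auto
    have Px: "P (Upper x) = Upper (p x)" "P (Upper (p x)) = Upper x"
      using PU[OF x] PU[OF in_range[OF x]] xy inv[of x] by auto
    \<comment> \<open>A vertical transversal at \<open>y\<close> would cross the arc from
      \<open>x\<close> to \<open>p x\<close>.\<close>
    have "p y \<noteq> y"
    proof
      assume "p y = y"
      then have "P (Upper y) = Lower y" using PU[OF y] by simp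
      with Px x y xy in_range[OF x] show False by (intro nc[of "Upper x" "Upper y"]) auto
    qed
    then have Py: "P (Upper y) = Upper (p y)" "P (Upper (p y)) = Upper y"
      using PU[OF y] PU[OF in_range[OF y]] inv[of y] by auto
    \<comment> \<open>If \<open>p y\<close> lay outside the arc over \<open>y\<close>, the two arcs
      would cross: on the right in the order \<open>x, y, p x, p y\<close>, on the left in the order
      \<open>p y, x, y, p x\<close>.\<close>
    have "p y \<noteq> x" "p y \<noteq> p x" using inv[of y] inv[of x] xy by auto
    moreover have "\<not> p x < p y"
      using nc[of "Upper x" "Upper y"] Px Py x y xy by auto
    moreover have "\<not> p y < x"
      using nc[of "Upper (p y)" "Upper x"] Px Py x in_range[OF y] xy by auto
    ultimately show ?thesis using \<open>p y \<noteq> y\<close> by auto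
  qed
  then have "half_diagram n p" unfolding half_diagram_def using inv out by blast
  moreover have "\<alpha> = diagram n p"
  proof (intro set_eqI iffI)
    fix B assume B: "B \<in> \<alpha>"
    then obtain v where v: "v \<in> B" using partition_onD3[OF part] by (metis ex_in_conv)
    then have "v \<in> vertices n" using B partition_onD1[OF part] by auto
    then show "B \<in> diagram n p" using block[OF B v] Ppartner by (auto simp: diagram_def)
  next
    fix B assume "B \<in> diagram n p"
    then show "B \<in> \<alpha>" using P(1) Ppartner by (auto simp: diagram_def)
  qed
  ultimately show ?thesis by (rule that)
qed

section \<open>Counting projections by rank\<close>

lemma TL_projections_eq: "TL_projections n r = diagram n ` half_diagrams n r"
proof (intro set_eqI iffI)
  fix \<alpha> assume "\<alpha> \<in> TL_projections n r"
  then have \<alpha>: "\<alpha> \<in> temperley_lieb n" "pstar \<alpha> = \<alpha>" "prank n \<alpha> = r"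
    by (auto simp: TL_projections_def is_projection_def)
  obtain p where "half_diagram n p" "\<alpha> = diagram n p"
    using symmetric_temperley_lieb_diagram[OF \<alpha>(1,2)] .
  then show "\<alpha> \<in> diagram n ` half_diagrams n r"
    using \<alpha>(3) prank_diagram by (auto simp: half_diagrams_def)
next
  fix \<alpha> assume "\<alpha> \<in> diagram n ` half_diagrams n r"
  then show "\<alpha> \<in> TL_projections n r"
    by (auto simp: half_diagrams_def TL_projections_def is_projection_def
        diagram_in_temperley_lieb pprod_diagram pstar_diagram prank_diagram)
qed

lemma card_TL_projections: "card (TL_projections n r) = card (half_diagrams n r)"
  unfolding TL_projections_eq
  by (rule card_image, rule inj_on_subset[OF inj_on_diagram]) (auto simp: half_diagrams_def)

lemma finite_TL_projections [simp]: "finite (TL_projections n r)"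
  by (simp add: TL_projections_eq)

lemma TL_projections_disjoint: "r \<noteq> s \<Longrightarrow> TL_projections n r \<inter> TL_projections n s = {}"
  by (auto simp: TL_projections_def)

lemma card_Q_TL:
  "card (Q_TL n) = (if even n
     then card (half_diagrams n 0) + card (half_diagrams n 2) + card (half_diagrams n 4)
     else card (half_diagrams n 1) + card (half_diagrams n 3))"
  by (simp add: Q_TL_def card_Un_disjoint Int_Un_distrib2 TL_projections_disjoint card_TL_projections)

section \<open>Ranks up to four in terms of Catalan numbers\<close>

lemma card_half_diagrams_even_0: "real (card (half_diagrams (2 * k) 0)) = catalan k"
  using card_half_diagrams[of 0 k] by (simp add: catalan_def)

text \<open>From here on the recurrence is read backwards: it is solved for the term with one more
  transversal on one point fewer.\<close>

lemma card_half_diagrams_odd_1: "real (card (half_diagrams (2 * k + 1) 1)) = catalan (k + 1)"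
  using card_half_diagrams_Suc[of "2 * k + 1" 0] card_half_diagrams_even_0[of "k + 1"] by simp

lemma card_half_diagrams_even_2:
  "real (card (half_diagrams (2 * k) 2)) = catalan (k + 1) - catalan k"
  using card_half_diagrams_Suc[of "2 * k" 1] card_half_diagrams_even_0[of k]
    card_half_diagrams_odd_1[of k] by (simp add: numeral_2_eq_2)

lemma card_half_diagrams_odd_3:
  "real (card (half_diagrams (2 * k + 1) 3)) = catalan (k + 2) - 2 * catalan (k + 1)"
  using card_half_diagrams_Suc[of "2 * k + 1" 2] card_half_diagrams_even_2[of "k + 1"]
    card_half_diagrams_odd_1[of k] by (simp add: numeral_3_eq_3)

text \<open>The two ranks are exactly the summands of the recurrence for \<open>2 * k + 1\<close>
  points and three transversals, so their sum comes out at once.\<close>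

lemma card_half_diagrams_even_2_4:
  "real (card (half_diagrams (2 * k) 2)) + real (card (half_diagrams (2 * k) 4)) =
     catalan (k + 2) - 2 * catalan (k + 1)"
  using card_half_diagrams_Suc[of "2 * k" 3] card_half_diagrams_odd_3[of k] by simp

theorem proposition7p8:
  fixes n k :: nat
  shows "(int n = 2 * int k - 1 \<longrightarrow>
            real (card (Q_TL n)) = catalan (k + 1) - catalan k) \<and>
         (n = 2 * k \<longrightarrow>
            real (card (Q_TL n)) = catalan (k + 2) - 2 * catalan (k + 1) + catalan k)"
proof (intro conjI impI)
  assume "int n = 2 * int k - 1"
  \<comment> \<open>Since \<open>n\<close> is nonnegative, \<open>k\<close> is at least 1 and the
    truncated subtraction is exact. The two ranks then add up to
    \<open>catalan (j + 1) + (catalan (j + 2) - 2 * catalan (j + 1))\<close>.\<close>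
  moreover define j where "j = k - 1"
  ultimately have "k = j + 1" "n = 2 * j + 1" by linarith+
  then show "real (card (Q_TL n)) = catalan (k + 1) - catalan k"
    using card_half_diagrams_odd_1[of j] card_half_diagrams_odd_3[of j] by (simp add: card_Q_TL)
next
  assume "n = 2 * k"
  then show "real (card (Q_TL n)) = catalan (k + 2) - 2 * catalan (k + 1) + catalan k"
    using card_half_diagrams_even_0[of k] card_half_diagrams_even_2_4[of k] by (simp add: card_Q_TL)
qed

end
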